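(* For all $n\ge 4$, $$|B_n| = |B_{n-1}| + |B_{n-3}| + 1,$$ with initial values $|B_1|=1$, $|B_2|=1$, $|B_3|=2$.
   Context: $S_n$ is the set of permutations of $\{1,\dots,n\}$ written in one-line notation. A permutation $\pi\in S_n$ avoids $132$ if there are no indices $i<j<k$ with $\pi_i<\pi_k<\pi_j$. Let $\mathcal{A}^{(2)}_n$ be the set of $\pi\in S_n$ that avoid $132$ and satisfy $|\pi_{i+1}-\pi_i|\le 2$ for all $1\le i<n$. Define $B_n=\{\pi\in\mathcal{A}^{(2)}_n : \pi_1=n\}$. *)

theory Defs
  imports "HOL-Combinatorics.Multiset_Permutations"
begin

text \<open>
  A permutation of \<open>{1..n}\<close> in one-line notation is a list in \<open>permutations_of_set {1..n}\<close>.
  List positions start at 0, so the \<open>i\<close>-th entry of a permutation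
  is \<open>xs ! (i - 1)\<close>.
\<close>

definition avoids_132 :: "nat list \<Rightarrow> bool" where
  "avoids_132 xs \<longleftrightarrow>
     \<not> (\<exists>i j k. i < j \<and> j < k \<and> k < length xs \<and> xs ! i < xs ! k \<and> xs ! k < xs ! j)"

definition A2 :: "nat \<Rightarrow> nat list set" where
  "A2 n = {xs \<in> permutations_of_set {1..n}. avoids_132 xs \<and>
     (\<forall>i. i + 1 < n \<longrightarrow> \<bar>int (xs ! (i + 1)) - int (xs ! i)\<bar> \<le> 2)}"

text \<open>Only meaningful for \<open>n \<ge> 1\<close>, since \<open>hd []\<close> is unspecified.\<close>

definition B :: "nat \<Rightarrow> nat list set" where
  "B n = {xs \<in> A2 n. hd xs = n}"

end

(*
  Consider the entry after the leading n of a permutation in B n.  If it is n - 1, dropping n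
  leaves a member of B (n - 1).  Otherwise it is n - 2, so the permutation is n # L @ (n - 1) # R
  where L starts with n - 2.  If R is nonempty, it has to start with n - 3, and avoiding 132 makes
  every entry of L larger than n - 3; hence L = [n - 2] and R is in B (n - 3).  If R is empty, the
  distance condition alone, applied from both ends inwards, forces the whole permutation to be
  n, n - 2, n - 4, ..., n - 3, n - 1.
*)
theory Submission
  imports Defs
begin

section \<open>Avoidance of 132 under extension and splitting of lists\<close>

lemma avoids_132_ConsD: "avoids_132 (x # xs) \<Longrightarrow> avoids_132 xs"
  unfolding avoids_132_def
  by (metis Suc_less_eq length_Cons nth_Cons_Suc)

text \<open>A new first entry can only play the 1 of a pattern 132, and the 3 and the 2 would then
  be two different values above \<open>x\<close>, so the 3 would be at least \<open>x + 2\<close>.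
  Allowing the value \<open>Suc x\<close> matters when \<open>n - 2\<close> is put before
  \<open>n - 1\<close>.\<close>

lemma avoids_132_ConsI:
  assumes "avoids_132 xs" "\<forall>y\<in>set xs. y \<le> Suc x"
  shows "avoids_132 (x # xs)"
  unfolding avoids_132_def
proof safe
  fix i j k
  assume ijk: "i < j" "j < k" "k < length (x # xs)"
    and less: "(x # xs) ! i < (x # xs) ! k" "(x # xs) ! k < (x # xs) ! j"
  obtain j' k' where jk: "j = Suc j'" "k = Suc k'"
    using ijk by (metis less_nat_zero_code not0_implies_Suc)
  show False
  proof (cases i)
    case 0
    have "xs ! j' \<le> Suc x" using assms(2) ijk jk by simp
    then show False using less 0 jk by simp
  next
    case (Suc i')
    then show False
      using assms(1) ijk less jk unfolding avoids_132_def by auto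
  qed
qed

text \<open>A new last entry can only play the 2, which needs a larger entry before it.\<close>

lemma avoids_132_snocI:
  assumes "avoids_132 xs" "\<forall>y\<in>set xs. y \<le> m"
  shows "avoids_132 (xs @ [m])"
  unfolding avoids_132_def
proof safe
  fix i j k
  assume ijk: "i < j" "j < k" "k < length (xs @ [m])"
    and less: "(xs @ [m]) ! i < (xs @ [m]) ! k" "(xs @ [m]) ! k < (xs @ [m]) ! j"
  show False
  proof (cases "k < length xs")
    case True
    then show False
      using assms(1) ijk less unfolding avoids_132_def by (auto simp: nth_append)
  next
    case False
    then have "k = length xs" "j < length xs" using ijk by auto
    then have "xs ! j \<le> m" using assms(2) by simp
    then show False using less \<open>k = length xs\<close> \<open>j < length xs\<close> by (simp add: nth_append)
  qed
qed

text \<open>Otherwise \<open>a\<close>, \<open>m\<close>, \<open>c\<close> would form a 132 pattern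
  with \<open>m\<close> as its 3.\<close>

lemma avoids_132_appendD:
  assumes "avoids_132 (L @ m # R)" "a \<in> set L" "c \<in> set R" "c < m"
  shows "c \<le> a"
proof (rule ccontr)
  assume "\<not> c \<le> a"
  obtain i where i: "i < length L" "L ! i = a" using assms(2) by (auto simp: in_set_conv_nth)
  obtain k where k: "k < length R" "R ! k = c" using assms(3) by (auto simp: in_set_conv_nth)
  let ?xs = "L @ m # R"
  have "?xs ! i = a" "?xs ! length L = m" "?xs ! (length L + Suc k) = c"
    using i k by (simp_all add: nth_append)
  moreover have "length L < length L + Suc k" "length L + Suc k < length ?xs" using k by auto
  ultimately show False
    using assms(1,4) i \<open>\<not> c \<le> a\<close> unfolding avoids_132_def by (metis not_le)
qed

section \<open>Membership in \<open>B n\<close> without indices\<close>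

abbreviation near :: "nat \<Rightarrow> nat \<Rightarrow> bool" where
  "near x y \<equiv> \<bar>int y - int x\<bar> \<le> 2"

text \<open>Stating the distance condition with \<open>successively\<close> lets it split along
  \<open>#\<close> and \<open>@\<close>, which is how the permutations are taken apart and rebuilt
  below.\<close>

lemma mem_B_iff:
  "xs \<in> B n \<longleftrightarrow>
     set xs = {1..n} \<and> distinct xs \<and> avoids_132 xs \<and> successively near xs \<and> hd xs = n"
proof -
  have "length xs = n" if "set xs = {1..n}" "distinct xs"
    using that distinct_card[of xs] by simp
  then show ?thesis
    unfolding B_def A2_def
    by (auto simp: permutations_of_set_def successively_conv_nth)
qed

lemma nonempty_of_mem_B: "xs \<in> B n \<Longrightarrow> 0 < n \<Longrightarrow> xs \<noteq> []"
  by (auto simp: mem_B_iff)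

lemma finite_B: "finite (B n)"
  by (rule finite_subset[of _ "permutations_of_set {1..n}"]) (auto simp: B_def A2_def)

section \<open>The zigzag permutation: entries of the parity of \<open>n\<close> descending, then
  the others ascending\<close>

fun zigzag :: "nat \<Rightarrow> nat list" where
  "zigzag 0 = []"
| "zigzag (Suc 0) = [1]"
| "zigzag (Suc (Suc n)) = Suc (Suc n) # zigzag n @ [Suc n]"

lemma zigzag_eq_Nil_iff: "zigzag n = [] \<longleftrightarrow> n = 0"
  by (cases n rule: zigzag.cases) auto

lemma hd_zigzag: "0 < n \<Longrightarrow> hd (zigzag n) = n"
  by (cases n rule: zigzag.cases) auto

lemma last_zigzag: "2 \<le> n \<Longrightarrow> last (zigzag n) = n - 1"
  by (cases n rule: zigzag.cases) auto

lemma set_zigzag: "set (zigzag n) = {1..n}"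
  by (induction n rule: zigzag.induct) auto

text \<open>Going from \<open>n\<close> to \<open>n + 2\<close> puts the new maximum in front and
  the second largest value at the end, so no pattern 132 arises; the new neighbours are at distance
  at most 2 because \<open>zigzag n\<close> starts with \<open>n\<close> and ends close to
  \<open>n\<close>.\<close>

lemma zigzag_mem_B: "0 < n \<Longrightarrow> zigzag n \<in> B n"
proof (induction n rule: zigzag.induct)
  case 1
  then show ?case by simp
next
  case 2
  then show ?case by (simp add: mem_B_iff avoids_132_def)
next
  case (3 n)
  show ?case
  proof (cases "n = 0")
    case True
    then show ?thesis
      by (auto simp: mem_B_iff avoids_132_def)
  next
    case False
    have IH: "zigzag n \<in> B n" using 3 False by simp
    \<comment> \<open>The last entry is \<open>n - 1\<close> except for \<open>n = 1\<close>, where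
      it is 1; these two bounds cover both cases.\<close>
    have last: "n \<le> Suc (last (zigzag n))" "last (zigzag n) \<le> n"
      using last_zigzag[of n] False by (cases "n = 1"; simp)+
    have "avoids_132 (zigzag (Suc (Suc n)))"
      using IH by (auto intro!: avoids_132_ConsI avoids_132_snocI simp: mem_B_iff)
    moreover have "successively near (zigzag (Suc (Suc n)))"
      using IH False last
      by (auto simp: mem_B_iff successively_append_iff successively_Cons zigzag_eq_Nil_iff)
    ultimately show ?thesis
      using IH by (auto simp: mem_B_iff set_zigzag)
  qed
qed

text \<open>Strip the end entries \<open>n\<close> and \<open>n - 1\<close>. What remains permutes
  \<open>{1..n - 2}\<close>; its first entry is within 2 of \<open>n\<close>, hence
  \<open>n - 2\<close>, and its last is within 2 of \<open>n - 1\<close> and differs from the first,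
  hence \<open>n - 3\<close>. So the same situation recurs for \<open>n - 2\<close>.\<close>

lemma mem_B_last_imp_zigzag:
  assumes "set xs = {1..n}" "distinct xs" "successively near xs"
    "hd xs = n" "last xs = n - 1" "2 \<le> n"
  shows "xs = zigzag n"
  using assms
proof (induction n arbitrary: xs rule: less_induct)
  case (less n)
  obtain ys where ys: "xs = n # ys" "ys \<noteq> []"
    using less.prems by (cases xs) (auto split: if_splits)
  obtain M where M: "xs = n # M @ [n - 1]"
    using ys less.prems by (cases ys rule: rev_cases) auto
  have "set M = {1..n} - {n, n - 1}"
    using less.prems(1,2,6) unfolding M by auto
  also have "\<dots> = {1..n - 2}" by auto
  finally have setM: "set M = {1..n - 2}" .
  \<comment> \<open>The induction hypothesis requires \<open>2 \<le> n - 2\<close>, so the two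
    smallest values are treated directly.\<close>
  consider "n = 2" | "n = 3" | "n \<ge> 4" using less.prems by linarith
  then show ?case
  proof cases
    case 1
    then show ?thesis using M setM by (simp add: numeral_eq_Suc)
  next
    case 2
    then have "set M = {1}" "distinct M" using setM less.prems M by auto
    moreover from this have "length M = 1" using distinct_card[of M] by simp
    then obtain a where "M = [a]" by (auto simp: length_Suc_conv)
    ultimately have "M = [1]" by simp
    then show ?thesis using M 2 by (simp add: numeral_eq_Suc)
  next
    case 3
    have ne: "M \<noteq> []" using setM 3 by auto
    have nears: "near n (hd M)" "near (last M) (n - 1)" "successively near M"
      using less.prems(3) ne unfolding M
      by (auto simp: successively_Cons successively_append_iff)
    have mem: "hd M \<in> {1..n - 2}" "last M \<in> {1..n - 2}"
      using ne setM hd_in_set last_in_set by blast+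
    have hd: "hd M = n - 2" using nears mem by auto
    \<comment> \<open>A distinct list with equal ends is a singleton, but \<open>M\<close> has
      \<open>n - 2 \<ge> 2\<close> entries.\<close>
    have "last M \<noteq> hd M"
    proof
      assume "last M = hd M"
      moreover have "distinct M" using less.prems(2) M by simp
      ultimately have "length M = 1" using ne
        by (cases M) (auto split: if_splits)
      moreover have "length M = n - 2"
        using distinct_card[OF \<open>distinct M\<close>] setM by simp
      ultimately show False using 3 by simp
    qed
    then have last: "last M = n - 2 - 1" using nears mem hd by auto
    have "M = zigzag (n - 2)"
      using less.IH[of "n - 2" M] hd last 3 setM less.prems(2) nears M by simp
    then show ?thesis
      using M zigzag.simps(3)[of "n - 2"] 3
      by (simp add: Suc_diff_Suc numeral_2_eq_2)
  qed
qed

section \<open>Decomposition of \<open>B n\<close> into three pieces, and the count\<close>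

lemma B_decomp:
  assumes "4 \<le> n"
  shows "B n = (#) n ` B (n - 1) \<union> (\<lambda>ys. n # (n - 2) # (n - 1) # ys) ` B (n - 3) \<union> {zigzag n}"
    (is "_ = ?U \<union> ?V \<union> _")
proof (intro equalityI subsetI)
  fix xs assume xs: "xs \<in> B n"
  obtain ys where ys: "xs = n # ys"
    using xs nonempty_of_mem_B[OF xs] assms by (cases xs) (auto simp: mem_B_iff)
  have ins: "insert n (set ys) = {1..n}" and "n \<notin> set ys"
    using xs ys by (auto simp: mem_B_iff)
  then have "set ys = {1..n} - {n}" by blast
  also have "{1..n} - {n} = {1..n - 1}" by auto
  finally have set_ys: "set ys = {1..n - 1}" .
  have ne: "ys \<noteq> []" using set_ys assms by auto
  have ys_props: "distinct ys" "avoids_132 ys" "successively near ys" "near n (hd ys)"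
    using xs ys ne by (auto simp: mem_B_iff successively_Cons dest: avoids_132_ConsD)
  have hd_mem: "hd ys \<in> {1..n - 1}" using ne set_ys hd_in_set by blast
  show "xs \<in> ?U \<union> ?V \<union> {zigzag n}"
  proof (cases "hd ys = n - 1")
    case True
    then have "ys \<in> B (n - 1)" using ys_props set_ys by (simp add: mem_B_iff)
    then show ?thesis using ys by blast
  next
    case False
    then have hd_ys: "hd ys = n - 2" using hd_mem ys_props(4) by auto
    have "n - 1 \<in> set ys" using set_ys assms by auto
    then obtain L R where LR: "ys = L @ (n - 1) # R" by (auto dest: split_list)
    have "L \<noteq> []" using LR False by auto
    then have "n - 2 \<in> set L" using LR hd_ys hd_in_set[of L] by simp
    show ?thesis
    proof (cases "R = []")
      case True
      then have "last xs = n - 1" using ys LR by simp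
      then show ?thesis
        using mem_B_last_imp_zigzag[of xs n] xs assms by (simp add: mem_B_iff)
    next
      case False
      have R_props: "distinct R" "avoids_132 R" "successively near R" "near (n - 1) (hd R)"
      proof -
        show "distinct R" "successively near R" "near (n - 1) (hd R)"
          using ys_props(1,3) False unfolding LR
          by (auto simp: successively_append_iff successively_Cons)
        have "avoids_132 R" if "avoids_132 (L @ (n - 1) # R)" for L
          using that by (induction L) (auto dest: avoids_132_ConsD)
        then show "avoids_132 R" using ys_props(2) LR by blast
      qed
      have "set R \<subseteq> set ys" using LR by auto
      then have R_sub: "set R \<subseteq> {1..n - 1} - {n - 1, n - 2}"
        using set_ys ys_props(1) \<open>n - 2 \<in> set L\<close> unfolding LR by auto
      \<comment> \<open>The first entry of \<open>R\<close> is at least \<open>n - 3\<close> by its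
        distance from \<open>n - 1\<close>, and both \<open>n - 1\<close> and \<open>n - 2\<close>
        occur before \<open>R\<close>.\<close>
      then have hd_R: "hd R = n - 3"
        using R_props(4) hd_in_set[OF False] by fastforce
      \<comment> \<open>With \<open>n - 1\<close> as the 3 and \<open>n - 3\<close> as the 2, an
        entry of \<open>L\<close> below \<open>n - 3\<close> would complete a 132; the values
        \<open>n - 3\<close> and \<open>n - 1\<close> themselves lie outside
        \<open>L\<close>.\<close>
      have "a = n - 2" if "a \<in> set L" for a
      proof -
        have "n - 3 \<in> set R" using hd_R hd_in_set[OF False] by simp
        then have "n - 3 \<le> a"
          using avoids_132_appendD[of L "n - 1" R a "n - 3"] ys_props(2) LR that assms by simp
        moreover have "a \<noteq> n - 3" "a \<noteq> n - 1"
          using \<open>n - 3 \<in> set R\<close> that ys_props(1) LR by auto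
        moreover have "a \<le> n - 1" using that set_ys LR by auto
        ultimately show ?thesis by linarith
      qed
      moreover have "distinct L" using ys_props(1) LR by simp
      ultimately have L: "L = [n - 2]"
        using \<open>L \<noteq> []\<close> by (metis distinct_length_2_or_more list.set_intros neq_Nil_conv)
      have "set R = {1..n - 1} - {n - 1, n - 2}"
        using set_ys ys_props(1) unfolding LR L by auto
      also have "\<dots> = {1..n - 3}" using assms by auto
      finally have "R \<in> B (n - 3)" using R_props hd_R by (simp add: mem_B_iff)
      then show ?thesis using ys LR L by simp
    qed
  qed
next
  fix xs assume "xs \<in> ?U \<union> ?V \<union> {zigzag n}"
  then consider (U) ys where "ys \<in> B (n - 1)" "xs = n # ys"
    | (V) ys where "ys \<in> B (n - 3)" "xs = n # (n - 2) # (n - 1) # ys"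
    | "xs = zigzag n" by blast
  then show "xs \<in> B n"
  proof cases
    case U
    then show ?thesis using assms nonempty_of_mem_B[OF U(1)]
      by (auto intro!: avoids_132_ConsI simp: mem_B_iff successively_Cons)
  next
    case V
    have "insert n (insert (n - 2) (insert (n - 1) {1..n - 3})) = {1..n}"
      using assms by auto
    \<comment> \<open>The entries \<open>n - 1\<close>, \<open>n - 2\<close>, \<open>n\<close> are
      prepended in this order. When \<open>n - 2\<close> is added, the largest entry after it is
      \<open>n - 1\<close>, exactly the successor that \<open>avoids_132_ConsI\<close>
      permits.\<close>
    moreover have "avoids_132 xs"
      using V assms by (auto intro!: avoids_132_ConsI simp: mem_B_iff)
    ultimately show ?thesis using V assms nonempty_of_mem_B[OF V(1)]
      by (auto simp: mem_B_iff successively_Cons)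
  next
    case 3
    then show ?thesis using zigzag_mem_B assms by simp
  qed
qed

text \<open>The pieces are disjoint: the second entry is \<open>n - 1\<close> in the first piece and
  \<open>n - 2\<close> in the other two, and \<open>zigzag n\<close> ends in \<open>n - 1\<close>,
  whereas members of the second piece end in a value at most \<open>n - 3\<close>. Both prepending
  maps are injective.\<close>

lemma card_B_rec:
  assumes "4 \<le> n"
  shows "card (B n) = card (B (n - 1)) + card (B (n - 3)) + 1"
proof -
  let ?f = "\<lambda>ys. n # (n - 2) # (n - 1) # ys"
  have disj: "(#) n ` B (n - 1) \<inter> ?f ` B (n - 3) = {}"
    using assms by (auto simp: mem_B_iff)
  have not_mem1: "zigzag n \<notin> (#) n ` B (n - 1)"
  proof
    assume "zigzag n \<in> (#) n ` B (n - 1)"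
    then have "hd (tl (zigzag n)) = n - 1" by (auto simp: mem_B_iff)
    moreover obtain m where "n = Suc (Suc m)" "0 < m"
      using assms by (cases n rule: zigzag.cases) auto
    ultimately show False by (simp add: zigzag_eq_Nil_iff hd_zigzag)
  qed
  have not_mem2: "zigzag n \<notin> ?f ` B (n - 3)"
  proof
    assume "zigzag n \<in> ?f ` B (n - 3)"
    then obtain ys where ys: "ys \<in> B (n - 3)" "zigzag n = ?f ys" by blast
    then have "ys \<noteq> []" using nonempty_of_mem_B assms by simp
    then have "last (zigzag n) \<in> set ys" using ys by simp
    then show False using ys(1) last_zigzag[of n] assms by (auto simp: mem_B_iff)
  qed
  have "card (B n) = card ((#) n ` B (n - 1)) + card (?f ` B (n - 3)) + 1"
    unfolding B_decomp[OF assms] using disj not_mem1 not_mem2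
    by (simp add: card_Un_disjoint finite_B)
  then show ?thesis by (simp add: card_image inj_on_def)
qed

section \<open>Initial values\<close>

lemma B_1: "B 1 = {[1]}"
proof (intro equalityI subsetI)
  fix xs assume xs: "xs \<in> B 1"
  then have "length xs = 1" using distinct_card[of xs] by (simp add: mem_B_iff)
  then obtain a where "xs = [a]" by (auto simp: length_Suc_conv)
  then show "xs \<in> {[1]}" using xs by (simp add: mem_B_iff)
qed (auto simp: mem_B_iff avoids_132_def)

lemma B_2: "B 2 = {[2, 1]}"
proof (intro equalityI subsetI)
  fix xs assume xs: "xs \<in> B 2"
  then have "length xs = 2" using distinct_card[of xs] by (simp add: mem_B_iff)
  then obtain a b where "xs = [a, b]" by (auto simp: length_Suc_conv numeral_2_eq_2)
  moreover have "{1..2} = {1, 2::nat}" by auto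
  ultimately show "xs \<in> {[2, 1]}" using xs by (auto simp: mem_B_iff)
next
  show "xs \<in> B 2" if "xs \<in> {[2, 1]}" for xs
    \<comment> \<open>\<open>[2, 1]\<close> is \<open>zigzag 2\<close>.\<close>
    using that zigzag_mem_B[of 2] by (simp add: numeral_2_eq_2)
qed

lemma B_3: "B 3 = {[3, 2, 1], [3, 1, 2]}"
proof (intro equalityI subsetI)
  fix xs assume xs: "xs \<in> B 3"
  then have "length xs = 3" using distinct_card[of xs] by (simp add: mem_B_iff)
  then obtain a b c where "xs = [a, b, c]" by (auto simp: length_Suc_conv numeral_3_eq_3)
  moreover have "{1..3} = {1, 2, 3::nat}" by auto
  ultimately show "xs \<in> {[3, 2, 1], [3, 1, 2]}" using xs by (auto simp: mem_B_iff)
next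
  have "{1..3} = {1, 2, 3::nat}" by auto
  moreover have avoids: "avoids_132 [2, 1]" using B_2 mem_B_iff[of "[2, 1]" 2] by simp
  moreover from avoids have "avoids_132 [3, 2, 1]" by (rule avoids_132_ConsI) simp
  ultimately have "[3, 2, 1] \<in> B 3" by (auto simp: mem_B_iff)
  \<comment> \<open>This one is \<open>zigzag 3\<close>.\<close>
  moreover have "[3, 1, 2] \<in> B 3"
    using zigzag_mem_B[of 3] by (simp add: numeral_3_eq_3 numeral_2_eq_2)
  ultimately show "xs \<in> B 3" if "xs \<in> {[3, 2, 1], [3, 1, 2]}" for xs
    using that by auto
qed

theorem lemma4p9:
  shows "(\<forall>n::nat. n \<ge> 4 \<longrightarrow> card (B n) = card (B (n - 1)) + card (B (n - 3)) + 1)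
    \<and> card (B 1) = 1 \<and> card (B 2) = 1 \<and> card (B 3) = 2"
  using card_B_rec by (simp add: B_1[simplified] B_2 B_3)

end
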